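(* Let $m\ge 1$ and let $P_1,\dots,P_m$ be i.i.d. uniformly distributed on $[0,1]$. Let $x\in(0,1)$ and, for every $i\in\{1,\dots,m\}$, let $x_i$ be the $x$-quantile of the $\beta(i,m+1-i)$ distribution, i.e. $\beta(i,m+1-i)(x_i)=x$. For $i\in\{1,\dots,m\}$ and $\boldsymbol a=(a_1,\dots,a_i)$ define the polynomial $$Q_i(y;\boldsymbol a):=\sum_{j=1}^{i}\frac{a_j}{(i+1-j)!}\,y^{\,i+1-j}.$$ For an integer $1\le c\le m$ define $\bar Q_{1,c}:=x_1$ and recursively, for $i\in\{2,\dots,m\}$, $$\bar Q_{i,c}:=Q_i\bigl(x_{\min(i,c)};(1,-\bar Q_{1,c},\dots,-\bar Q_{i-1,c})\bigr).$$ (i) If $1\le c\le m$ is a fixed integer, then $$\gamma_{\infty,c}(x)=x_c^m+\sum_{i=1}^{m-1}\frac{m!}{(m-i)!}\,\bar Q_{i,c}\,\bigl(1-x_c^{\,m-i}\bigr).$$ (ii) Let $\tau\in(0,1)$, define $\tilde Q_1:=\tau$ and, for $i\in\{2,\dots,m\}$, $\tilde Q_i:=Q_i(\tau;(1,-\bar Q_{1,m},\dots,-\bar Q_{i-1,m}))$. If $c$ is the random variable $c=\max(\{i\in\{1,\dots,m\}:P_{(i)}<\tau\}\cup\{1\})$, then $$\gamma_{\infty,c}(x)=(1-\tau)^m\,\frac{x-\beta(1,m)(\tau)}{1-\beta(1,m)(\tau)}\,I(x_1>\tau)+\sum_{i=1}^{m}\binom{m}{i}\tau^i(1-\tau)^{m-i}\Bigl\{1-\frac{i!}{\tau^i}\bigl(\tilde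 Q_i-\bar Q_{i,m}\bigr)I(x_i\le\tau)\Bigr\}.$$
   Context: Notation: $\beta(a,b)(\cdot)$ denotes the CDF of the Beta$(a,b)$ distribution; $I(\cdot)$ is the indicator; $P_{(1)}\le\dots\le P_{(m)}$ are the order statistics of $P_1,\dots,P_m$. Define $Y_k:=\beta(k,m+1-k)(P_{(k)})$ for $k=1,\dots,m$. For a (fixed or random) integer $c\in\{1,\dots,m\}$, the test statistic is $Z_{\infty,c}:=\min(Y_1,\dots,Y_c)$, the global minimum of $Y_1,\dots,Y_c$, and $\gamma_{\infty,c}(x):=\mathbb P(Z_{\infty,c}\le x)$ is its CDF. *)

theory Defs
  imports "HOL-Probability.Probability"
begin

definition beta_density :: "real \<Rightarrow> real \<Rightarrow> real \<Rightarrow> real" where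
  "beta_density a b t =
     t powr (a - 1) * (1 - t) powr (b - 1) / Beta a b * indicator {0<..<1} t"

definition beta_distribution :: "real \<Rightarrow> real \<Rightarrow> real measure" where
  "beta_distribution a b = density lborel (\<lambda>t. ennreal (beta_density a b t))"

definition beta_cdf :: "real \<Rightarrow> real \<Rightarrow> real \<Rightarrow> real" where
  "beta_cdf a b = cdf (beta_distribution a b)"

text \<open>The \<open>k\<close>-th smallest of \<open>p 1, \<dots>, p m\<close>, for \<open>1 \<le> k \<le> m\<close>.\<close>

definition order_stat :: "nat \<Rightarrow> (nat \<Rightarrow> real) \<Rightarrow> nat \<Rightarrow> real" where
  "order_stat m p k = sort (map p [1..<m + 1]) ! (k - 1)"

definition Y_stat :: "nat \<Rightarrow> (nat \<Rightarrow> real) \<Rightarrow> nat \<Rightarrow> real" where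
  "Y_stat m p k = beta_cdf (real k) (real (m + 1 - k)) (order_stat m p k)"

definition Z_inf :: "nat \<Rightarrow> nat \<Rightarrow> (nat \<Rightarrow> real) \<Rightarrow> real" where
  "Z_inf m c p = Min (Y_stat m p ` {1..c})"

text \<open>The cutoff \<open>c\<close> may depend on the outcome; a fixed cutoff is a constant function.\<close>

definition gamma_inf ::
    "'a measure \<Rightarrow> nat \<Rightarrow> (nat \<Rightarrow> 'a \<Rightarrow> real) \<Rightarrow> ('a \<Rightarrow> nat) \<Rightarrow> real \<Rightarrow> real" where
  "gamma_inf M m P c x =
     measure M {\<omega> \<in> space M. Z_inf m (c \<omega>) (\<lambda>i. P i \<omega>) \<le> x}"

text \<open>The coefficient vector \<open>(a\<^sub>1, \<dots>, a\<^sub>i)\<close> is a list of length \<open>i\<close>, so that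
  \<open>a\<^sub>j\<close> is \<open>as ! (j - 1)\<close>.\<close>

definition Q_poly :: "nat \<Rightarrow> real \<Rightarrow> real list \<Rightarrow> real" where
  "Q_poly i y as = (\<Sum>j = 1..i. as ! (j - 1) / fact (i + 1 - j) * y ^ (i + 1 - j))"

text \<open>The value at index \<open>0\<close> is junk.\<close>

fun Q_bar :: "(nat \<Rightarrow> real) \<Rightarrow> nat \<Rightarrow> nat \<Rightarrow> real" where
  "Q_bar q c i =
     (if i \<le> 1 then q 1
      else Q_poly i (q (min i c)) (1 # map (\<lambda>j. - Q_bar q c j) [1..<i]))"

declare Q_bar.simps [simp del]

definition Q_tilde :: "(nat \<Rightarrow> real) \<Rightarrow> nat \<Rightarrow> real \<Rightarrow> nat \<Rightarrow> real" where
  "Q_tilde q m \<tau> i =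
     (if i \<le> 1 then \<tau>
      else Q_poly i \<tau> (1 # map (\<lambda>j. - Q_bar q m j) [1..<i]))"

definition random_cutoff :: "nat \<Rightarrow> real \<Rightarrow> (nat \<Rightarrow> real) \<Rightarrow> nat" where
  "random_cutoff m \<tau> p = Max ({i \<in> {1..m}. order_stat m p i < \<tau>} \<union> {1})"

end

theory Submission
  imports Defs
begin

text \<open>
  Write \<open>N(t)\<close> for the number of the \<open>P\<^sub>j\<close> that are at most \<open>t\<close>. The Beta distribution with parameters \<open>k\<close>
  and \<open>m + 1 - k\<close> is the law of \<open>P\<^sub>(\<^sub>k\<^sub>)\<close>, with distribution function \<open>P(Bin(m, t) \<ge> k)\<close>. It is strictly increasing
  in \<open>t\<close> on the unit interval and decreasing in \<open>k\<close>, so the quantiles \<open>x\<^sub>1 < \<dots> < x\<^sub>m\<close> are increasing, and the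
  test survives, that is \<open>Z\<^sub>\<infinity>\<^sub>,\<^sub>c > x\<close>, exactly when \<open>N(x\<^sub>k) < k\<close> for all \<open>k \<le> c\<close>
  (\<open>gamma_inf_eq_survival\<close>): the ordered values stay above an increasing barrier.

  The heart of the proof is the probability that \<open>n\<close> of the variables are at most \<open>t\<close> and stay above an increasing
  barrier \<open>b\<^sub>1 \<le> \<dots> \<le> b\<^sub>n \<le> t\<close>. It equals \<open>n! V\<^sub>n(t)\<close>, where \<open>V\<^sub>n\<close> is the Appell sequence with
  \<open>V\<^sub>0 = 1\<close>, \<open>V\<^sub>n' = V\<^sub>n\<^sub>-\<^sub>1\<close> and \<open>V\<^sub>n(b\<^sub>n) = 0\<close> (\<open>prob_avoids_barrier\<close>). To see this,
  split the variables at \<open>s = b\<^sub>n\<close>. At least one of them exceeds \<open>s\<close>. The \<open>k < n\<close> values up to \<open>s\<close> have to avoid the barrier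
  \<open>b\<^sub>1, \<dots>, b\<^sub>k\<close>, independently of the others, which are merely located between \<open>s\<close> and \<open>t\<close>. By induction the probability
  is the sum of \<open>(n choose k) k! V\<^sub>k(s) (t - s)\<^sup>n\<^sup>-\<^sup>k\<close> over \<open>k < n\<close>, which is \<open>n!\<close> times the Taylor expansion of \<open>V\<^sub>n\<close> at
  its zero \<open>s\<close> (\<open>appell_shift\<close>).

  The numbers \<open>Q_bar\<close> are minus the constant terms of the \<open>V\<^sub>n\<close> for the barrier \<open>b\<^sub>n = q (min n c)\<close>
  (\<open>appell_Q_bar_zero\<close>), and the difference of \<open>Q_tilde\<close> and \<open>Q_bar\<close> in the second formula is \<open>V\<^sub>i(\<tau>)\<close>. For a fixed cutoff all \<open>m\<close>
  variables are used with \<open>t = 1\<close>. For the random cutoff one conditions on the set of variables below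
  \<open>\<tau>\<close>: if it has \<open>i \<ge> 1\<close> elements, then the cutoff is \<open>i\<close> and these variables have to avoid the barrier with \<open>t = \<tau>\<close>;
  if it is empty, the cutoff is \<open>1\<close> and all variables have to exceed both \<open>\<tau>\<close> and \<open>x\<^sub>1\<close>.
\<close>

section \<open>Order statistics as counts\<close>

text \<open>
  The entries with property \<open>D\<close> form an initial segment of a sorted list, so its \<open>k\<close>-th entry
  has \<open>D\<close> exactly when that segment is long enough. Stating this for downward closed \<open>D\<close> covers
  both \<open>\<le> t\<close> (the rejection thresholds) and \<open>< t\<close> (the random cutoff).
\<close>

lemma sorted_nth_downward_closed_iff:
  fixes xs :: "'a::linorder list"
  assumes "sorted xs" "k < length xs" and down: "\<And>x y. x \<le> y \<Longrightarrow> D y \<Longrightarrow> D x"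
  shows "D (xs ! k) \<longleftrightarrow> k < length (filter D xs)"
  using assms(1,2)
proof (induction xs arbitrary: k)
  case (Cons a xs)
  show ?case
  proof (cases "D a")
    case True
    then show ?thesis using Cons by (cases k) auto
  next
    case False
    then have "\<not> D y" if "y \<in> set (a # xs)" for y
      using that Cons.prems(1) down by auto
    then show ?thesis using Cons.prems(2)
      by (metis filter_False length_greater_0_conv nth_mem not_less_zero list.size(3))
  qed
qed simp

lemma order_stat_downward_closed_iff:
  assumes "k \<in> {1..m}" and down: "\<And>x y. x \<le> y \<Longrightarrow> D y \<Longrightarrow> D x"
  shows "D (order_stat m p k) \<longleftrightarrow> k \<le> card {j \<in> {1..m}. D (p j)}"
proof -
  let ?xs = "map p [1..<m + 1]"
  have "length (filter D (sort ?xs)) = length (filter D ?xs)"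
    by (metis filter_sort length_sort)
  also have "\<dots> = length (filter (\<lambda>j. D (p j)) [1..<m + 1])"
    by (simp add: filter_map o_def del: upt_Suc)
  also have "\<dots> = card (set (filter (\<lambda>j. D (p j)) [1..<m + 1]))"
    by (metis distinct_card distinct_filter distinct_upt)
  also have "set (filter (\<lambda>j. D (p j)) [1..<m + 1]) = {j \<in> {1..m}. D (p j)}"
    by auto
  finally have "length (filter D (sort ?xs)) = card {j \<in> {1..m}. D (p j)}" .
  moreover have "k - 1 < length (sort ?xs)" using assms(1) by auto
  ultimately have "D (order_stat m p k) \<longleftrightarrow> k - 1 < card {j \<in> {1..m}. D (p j)}"
    unfolding order_stat_def
    using sorted_nth_downward_closed_iff[of "sort ?xs" "k - 1" D, OF sorted_sort _ down] by simp
  then show ?thesis using assms(1) by (cases k) (auto simp: Suc_le_eq)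
qed

lemma random_cutoff_eq:
  "random_cutoff m \<tau> p = max 1 (card {j \<in> {1..m}. p j < \<tau>})"
proof -
  let ?N = "card {j \<in> {1..m}. p j < \<tau>}"
  have "?N \<le> card {1..m}" by (intro card_mono) auto
  then have "?N \<le> m" by simp
  have "{i \<in> {1..m}. order_stat m p i < \<tau>} = {i \<in> {1..m}. i \<le> ?N}"
    using order_stat_downward_closed_iff[of _ m "\<lambda>y. y < \<tau>" p] by auto
  also have "\<dots> = {1..?N}" using \<open>?N \<le> m\<close> by auto
  finally have "random_cutoff m \<tau> p = Max ({1..?N} \<union> {1})"
    by (simp add: random_cutoff_def)
  also have "\<dots> = max 1 ?N" by (intro Max_eqI) (auto simp: max_def)
  finally show ?thesis .
qed

section \<open>The Beta distribution of an order statistic\<close>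

text \<open>
  The probability that at least \<open>i\<close> of \<open>m\<close> independent uniform variables are at most \<open>t\<close>, that is
  \<open>P\<^sub>(\<^sub>i\<^sub>) \<le> t\<close>.
\<close>

definition binomial_tail :: "nat \<Rightarrow> nat \<Rightarrow> real \<Rightarrow> real" where
  "binomial_tail m i t = (\<Sum>k = i..m. real (m choose k) * t ^ k * (1 - t) ^ (m - k))"

definition order_stat_density :: "nat \<Rightarrow> nat \<Rightarrow> real \<Rightarrow> real" where
  "order_stat_density m i t = real i * real (m choose i) * t ^ (i - 1) * (1 - t) ^ (m - i)"

text \<open>
  Downward induction on \<open>i\<close>: the sum telescopes, since differentiating the term with \<open>k = i\<close> gives the
  density for \<open>i\<close> minus the density for \<open>i + 1\<close>.
\<close>

lemma binomial_tail_has_derivative: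
  assumes "1 \<le> i" "i \<le> m"
  shows "(binomial_tail m i has_real_derivative order_stat_density m i t) (at t)"
  using assms(2,1)
proof (induction i rule: inc_induct)
  case base
  have "binomial_tail m m = (\<lambda>t. t ^ m)" by (auto simp: binomial_tail_def)
  then show ?case
    by (auto simp: order_stat_density_def intro!: derivative_eq_intros)
next
  case (step i)
  have eq: "binomial_tail m i
      = (\<lambda>t. real (m choose i) * t ^ i * (1 - t) ^ (m - i) + binomial_tail m (Suc i) t)"
    using step.hyps by (auto simp: binomial_tail_def sum.atLeast_Suc_atMost)
  have d: "real (Suc i) * real (m choose Suc i) = real (m - i) * real (m choose i)"
  proof -
    have "Suc i * (m choose Suc i) = (m - i) * (m choose i)"
      by (metis binomial_absorb_comp binomial_absorption mult.commute)
    then show ?thesis by (metis of_nat_mult)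
  qed
  have "((\<lambda>t. real (m choose i) * t ^ i * (1 - t) ^ (m - i)) has_real_derivative
      real (m choose i) * (real i * t ^ (i - 1) * (1 - t) ^ (m - i)
        - real (m - i) * t ^ i * (1 - t) ^ (m - i - 1))) (at t)"
    by (auto intro!: derivative_eq_intros simp: algebra_simps)
  from DERIV_add[OF this step.IH] show ?case
    unfolding eq
    by (rule DERIV_cong) (use d in \<open>simp_all add: order_stat_density_def algebra_simps\<close>)
qed

lemma order_stat_density_pos:
  assumes "1 \<le> i" "i \<le> m" "0 < t" "t < 1"
  shows "0 < order_stat_density m i t"
  using assms by (auto simp: order_stat_density_def intro!: mult_pos_pos)

lemma binomial_tail_strict_mono:
  assumes "1 \<le> i" "i \<le> m" "0 \<le> s" "s < t" "t \<le> 1"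
  shows "binomial_tail m i s < binomial_tail m i t"
proof (rule DERIV_pos_imp_increasing_open[OF \<open>s < t\<close>])
  show "\<exists>y. (binomial_tail m i has_real_derivative y) (at u) \<and> 0 < y" if "s < u" "u < t" for u
    using binomial_tail_has_derivative[of i m u] order_stat_density_pos[of i m u] assms that
    by auto
  show "continuous_on {s..t} (binomial_tail m i)"
    by (intro continuous_at_imp_continuous_on ballI DERIV_isCont[OF binomial_tail_has_derivative])
       (use assms in auto)
qed

lemma binomial_tail_strict_antimono_index:
  assumes "i < k" "k \<le> m" "0 < t" "t < 1"
  shows "binomial_tail m k t < binomial_tail m i t"
  unfolding binomial_tail_def
  by (rule sum_strict_mono2[where b = i]) (use assms in auto)

lemma binomial_tail_at_0: "1 \<le> i \<Longrightarrow> binomial_tail m i 0 = 0"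
  by (auto simp: binomial_tail_def)

lemma binomial_tail_at_1: "i \<le> m \<Longrightarrow> binomial_tail m i 1 = 1"
proof -
  assume "i \<le> m"
  have "binomial_tail m i 1 = (\<Sum>k = i..m. if k = m then 1 else 0)"
    unfolding binomial_tail_def by (intro sum.cong) auto
  then show ?thesis using \<open>i \<le> m\<close> by simp
qed

lemma beta_density_order_stat:
  assumes "1 \<le> i" "i \<le> m" "0 < t" "t < 1"
  shows "beta_density (real i) (real (m + 1 - i)) t = order_stat_density m i t"
proof -
  have "Gamma (real i) = fact (i - 1)"
    using Gamma_fact[of "i - 1", where 'a=real] assms(1) by (simp add: of_nat_diff)
  moreover have "Gamma (real (m + 1 - i)) = fact (m - i)"
    using Gamma_fact[of "m - i", where 'a=real] assms(2) by (simp add: of_nat_diff algebra_simps)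
  moreover have "real i + real (m + 1 - i) = 1 + real m" using assms by simp
  ultimately have B: "Beta (real i) (real (m + 1 - i)) = fact (i - 1) * fact (m - i) / fact m"
    by (simp add: Beta_def Gamma_fact del: of_nat_add of_nat_diff)
  have "real i * real (m choose i) = fact m / (fact (i - 1) * fact (m - i))"
    using assms by (simp add: binomial_fact fact_reduce[of i])
  moreover have "t powr (real i - 1) = t ^ (i - 1)"
    using assms powr_realpow[of t "i - 1"] by (simp add: of_nat_diff)
  moreover have "(1 - t) powr (real (m + 1 - i) - 1) = (1 - t) ^ (m - i)"
    using assms powr_realpow[of "1 - t" "m - i"] by (simp add: of_nat_diff)
  ultimately show ?thesis
    using assms(3,4) unfolding beta_density_def B order_stat_density_def by simp
qed

text \<open>
  Both sides are antiderivatives of the Beta density on the unit interval, outside of which the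
  distribution has no mass; hence the clamping of \<open>t\<close>.
\<close>

lemma beta_cdf_eq_binomial_tail:
  assumes "1 \<le> i" "i \<le> m"
  shows "beta_cdf (real i) (real (m + 1 - i)) t = binomial_tail m i (max 0 (min 1 t))"
proof -
  let ?f = "beta_density (real i) (real (m + 1 - i))" and ?g = "order_stat_density m i"
  let ?u = "max 0 (min 1 t)"
  have meas: "?f \<in> borel_measurable borel" "?g \<in> borel_measurable borel"
    unfolding beta_density_def[abs_def] order_stat_density_def[abs_def] by measurable
  have mono: "binomial_tail m i 0 \<le> binomial_tail m i ?u"
  proof (cases "?u = 0")
    case False
    then have "0 < ?u" "?u \<le> 1" by auto
    then show ?thesis using binomial_tail_strict_mono[OF assms, of 0 ?u] by linarith
  qed simp
  have "emeasure (beta_distribution (real i) (real (m + 1 - i))) {..t}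
      = (\<integral>\<^sup>+ y. ennreal (?f y) * indicator {..t} y \<partial>lborel)"
    unfolding beta_distribution_def using meas by (subst emeasure_density) auto
  also have "\<dots> = (\<integral>\<^sup>+ y. ennreal (?g y) * indicator {0..?u} y \<partial>lborel)"
  proof (rule nn_integral_cong_AE)
    have "AE y in lborel. y \<noteq> (0::real)" "AE y in lborel. y \<noteq> (1::real)" "AE y in lborel. y \<noteq> t"
      by (rule AE_lborel_singleton)+
    then show "AE y in lborel. ennreal (?f y) * indicator {..t} y
        = ennreal (?g y) * indicator {0..?u} y"
    proof eventually_elim
      case (elim y)
      show ?case
      proof (cases "0 < y \<and> y < 1")
        case True
        then show ?thesis
          using beta_density_order_stat[OF assms, of y] by (auto simp: indicator_def)
      next
        case False
        then show ?thesis using elim by (auto simp: beta_density_def indicator_def)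
      qed
    qed
  qed
  also have "\<dots> = ennreal (binomial_tail m i ?u - binomial_tail m i 0)"
  proof (rule nn_integral_FTC_Icc)
    fix y assume "y \<in> {0..?u}"
    then show "0 \<le> ?g y" by (auto simp: order_stat_density_def)
    show "(binomial_tail m i has_real_derivative ?g y) (at y)"
      by (rule binomial_tail_has_derivative[OF assms])
  qed (use meas in auto)
  finally show ?thesis
    using mono assms by (simp add: beta_cdf_def cdf_def measure_def binomial_tail_at_0)
qed

text \<open>
  The cumulative distribution function is flat outside the unit interval and strictly increasing
  inside, so a level strictly between \<open>0\<close> and \<open>1\<close> is attained at one point only. This is what turns
  \<open>Y\<^sub>k \<le> x\<close> into \<open>P\<^sub>(\<^sub>k\<^sub>) \<le> x\<^sub>k\<close>.
\<close>

lemma beta_quantile: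
  assumes "1 \<le> i" "i \<le> m" "0 < x" "x < 1" "beta_cdf (real i) (real (m + 1 - i)) q = x"
  shows "0 < q" "q < 1" "binomial_tail m i q = x"
    and "beta_cdf (real i) (real (m + 1 - i)) p \<le> x \<longleftrightarrow> p \<le> q"
proof -
  note cdf = beta_cdf_eq_binomial_tail[OF assms(1,2)]
  show q: "0 < q"
  proof (rule ccontr)
    assume "\<not> 0 < q"
    then have "max 0 (min 1 q) = 0" by auto
    then show False using assms cdf[of q] binomial_tail_at_0[of i m] by simp
  qed
  show q1: "q < 1"
  proof (rule ccontr)
    assume "\<not> q < 1"
    then have "max 0 (min 1 q) = 1" by auto
    then show False using assms cdf[of q] binomial_tail_at_1[of i m] by simp
  qed
  show x: "binomial_tail m i q = x"
    using q q1 cdf[of q] assms(5) by (simp add: max_def min_def)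
  define u where "u = max 0 (min 1 p)"
  have "0 \<le> u" "u \<le> 1" by (auto simp: u_def)
  then have "binomial_tail m i u \<le> binomial_tail m i q \<longleftrightarrow> u \<le> q"
    using binomial_tail_strict_mono[OF assms(1,2), of q u]
      binomial_tail_strict_mono[OF assms(1,2), of u q] q q1
    by (cases q u rule: linorder_cases) auto
  then show "beta_cdf (real i) (real (m + 1 - i)) p \<le> x \<longleftrightarrow> p \<le> q"
    using q q1 x cdf[of p] by (auto simp: u_def)
qed

text \<open>
  A higher order statistic is stochastically larger: its binomial tail has fewer terms. This makes
  the thresholds \<open>x\<^sub>1, \<dots>, x\<^sub>m\<close> an increasing barrier.
\<close>

lemma quantile_strict_mono:
  assumes "1 \<le> i" "i < k" "k \<le> m" "0 < x" "x < 1"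
    and "beta_cdf (real i) (real (m + 1 - i)) q = x" "beta_cdf (real k) (real (m + 1 - k)) r = x"
  shows "q < r"
proof -
  note q = beta_quantile[OF _ _ assms(4,5,6)] and r = beta_quantile[OF _ _ assms(4,5,7)]
  have "binomial_tail m k q < binomial_tail m i q"
    using q(1,2) assms by (intro binomial_tail_strict_antimono_index) auto
  also have "\<dots> = binomial_tail m k r" using q(3) r(3) assms by auto
  finally show ?thesis
    using binomial_tail_strict_mono[of k m r q] q(1,2) r(1,2) assms
    by (cases q r rule: linorder_cases) auto
qed

lemma Z_inf_le_iff:
  assumes "1 \<le> c" "c \<le> m" "0 < x" "x < 1"
    and "\<And>i. i \<in> {1..m} \<Longrightarrow> beta_cdf (real i) (real (m + 1 - i)) (q i) = x"
  shows "Z_inf m c p \<le> x \<longleftrightarrow> (\<exists>k\<in>{1..c}. k \<le> card {j \<in> {1..m}. p j \<le> q k})"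
proof -
  have "Z_inf m c p \<le> x \<longleftrightarrow> (\<exists>k\<in>{1..c}. Y_stat m p k \<le> x)"
    using assms(1) unfolding Z_inf_def by (subst Min_le_iff) auto
  also have "\<dots> \<longleftrightarrow> (\<exists>k\<in>{1..c}. order_stat m p k \<le> q k)"
    unfolding Y_stat_def using beta_quantile(4)[OF _ _ assms(3,4,5)] assms(2) by (intro bex_cong) auto
  also have "\<dots> \<longleftrightarrow> (\<exists>k\<in>{1..c}. k \<le> card {j \<in> {1..m}. p j \<le> q k})"
    using assms(2) by (intro bex_cong refl order_stat_downward_closed_iff) auto
  finally show ?thesis .
qed

lemma binomial_tail_from_1:
  assumes "1 \<le> m"
  shows "binomial_tail m 1 t = 1 - (1 - t) ^ m"
proof -
  have "(\<Sum>k\<le>m. real (m choose k) * t ^ k * (1 - t) ^ (m - k)) = 1"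
    using binomial_ring[of t "1 - t" m] by simp
  then have "(1 - t) ^ m + binomial_tail m 1 t = 1"
    unfolding atMost_atLeast0 by (simp add: sum.atLeast_Suc_atMost binomial_tail_def)
  then show ?thesis by simp
qed

section \<open>Appell polynomials\<close>

text \<open>
  The Appell sequence with constant terms \<open>a\<close>: the derivative of the \<open>n\<close>-th polynomial is the one
  with index \<open>n - 1\<close>, and every constant of integration is \<open>a n\<close>. With \<open>a 0 = 1\<close> and a
  zero of the \<open>n\<close>-th polynomial at \<open>b n\<close>, for every \<open>n \<ge> 1\<close>, these are, up to the factor \<open>n!\<close>, the
  Goncarov polynomials of the nodes \<open>b\<close>.
\<close>

definition appell :: "(nat \<Rightarrow> real) \<Rightarrow> nat \<Rightarrow> real \<Rightarrow> real" where
  "appell a n t = (\<Sum>j\<le>n. a j * t ^ (n - j) / fact (n - j))"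

lemma appell_Suc: "appell a n t = a n + (\<Sum>j<n. a j * t ^ (n - j) / fact (n - j))"
  by (simp add: appell_def lessThan_Suc_atMost[symmetric])

text \<open>
  The binomial theorem in terms of divided powers, where it is a plain convolution.
\<close>

lemma power_add_div_fact:
  fixes u v :: real
  shows "(u + v) ^ n / fact n = (\<Sum>k\<le>n. u ^ k / fact k * (v ^ (n - k) / fact (n - k)))"
  unfolding binomial_ring sum_divide_distrib
  by (intro sum.cong refl) (simp add: binomial_fact)

text \<open>
  Taylor expansion at \<open>s\<close>: the derivative of order \<open>n - k\<close> of the \<open>n\<close>-th polynomial is the \<open>k\<close>-th one.
  Algebraically, the sequence is the convolution of \<open>a\<close> with the divided powers of \<open>t\<close>, and the
  latter are the convolution of those of \<open>s\<close> and of \<open>t - s\<close>.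
\<close>

lemma appell_shift:
  "appell a n t = (\<Sum>k\<le>n. appell a k s * (t - s) ^ (n - k) / fact (n - k))"
proof -
  have "appell a n t = (\<Sum>j\<le>n. a j * ((s + (t - s)) ^ (n - j) / fact (n - j)))"
    by (simp add: appell_def)
  also have "\<dots> = (\<Sum>j\<le>n. \<Sum>i\<le>n - j. a j * (s ^ i / fact i * ((t - s) ^ (n - j - i) / fact (n - j - i))))"
    by (simp only: power_add_div_fact sum_distrib_left)
  also have "\<dots> = (\<Sum>(j, i)\<in>(SIGMA j:{..n}. {..n - j}). a j * (s ^ i / fact i * ((t - s) ^ (n - j - i) / fact (n - j - i))))"
    by (rule sum.Sigma) auto
  also have "\<dots> = (\<Sum>(k, j)\<in>(SIGMA k:{..n}. {..k}). a j * s ^ (k - j) / fact (k - j) * ((t - s) ^ (n - k) / fact (n - k)))"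
    by (rule sum.reindex_bij_witness[where i = "\<lambda>(k, j). (j, k - j)" and j = "\<lambda>(j, i). (j + i, j)"]) auto
  also have "\<dots> = (\<Sum>k\<le>n. \<Sum>j\<le>k. a j * s ^ (k - j) / fact (k - j) * ((t - s) ^ (n - k) / fact (n - k)))"
    by (rule sum.Sigma[symmetric]) auto
  also have "\<dots> = (\<Sum>k\<le>n. appell a k s * (t - s) ^ (n - k) / fact (n - k))"
    by (simp add: appell_def sum_distrib_right sum_divide_distrib)
  finally show ?thesis .
qed

section \<open>Points that avoid an increasing barrier\<close>

text \<open>
  For every \<open>k\<close>, the \<open>k\<close>-th smallest of the values \<open>f j\<close> with \<open>j \<in> U\<close> lies above \<open>b k\<close>. Counts express
  this without sorting, so that it can be split over subsets of \<open>U\<close>.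
\<close>

definition avoids_barrier :: "(nat \<Rightarrow> real) \<Rightarrow> nat set \<Rightarrow> (nat \<Rightarrow> real) \<Rightarrow> bool" where
  "avoids_barrier b U f \<longleftrightarrow> (\<forall>k\<in>{1..card U}. card {j \<in> U. f j \<le> b k} < k)"

lemma avoids_barrier_restrict [simp]:
  "avoids_barrier b U (restrict f U) \<longleftrightarrow> avoids_barrier b U f"
  unfolding avoids_barrier_def by (simp cong: conj_cong)

text \<open>
  Let \<open>U\<close> consist of the indices of the values up to \<open>s\<close>. For the first \<open>card U\<close> constraints only
  these values matter: if \<open>b k \<le> s\<close>, no other value is counted, and if \<open>b k > s\<close>, all of \<open>U\<close> is counted
  and the constraint fails on both sides.
\<close>

lemma avoids_barrier_split:
  assumes "finite T" and "\<And>j. j \<in> T \<Longrightarrow> f j \<le> s \<Longrightarrow> j \<in> U" "U \<subseteq> T" "\<And>j. j \<in> U \<Longrightarrow> f j \<le> s"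
  shows "(\<forall>k\<in>{1..card U}. card {j \<in> T. f j \<le> b k} < k) \<longleftrightarrow> avoids_barrier b U f"
  unfolding avoids_barrier_def
proof (intro ball_cong refl)
  fix k assume k: "k \<in> {1..card U}"
  show "card {j \<in> T. f j \<le> b k} < k \<longleftrightarrow> card {j \<in> U. f j \<le> b k} < k"
  proof (cases "b k \<le> s")
    case True
    then have "{j \<in> T. f j \<le> b k} = {j \<in> U. f j \<le> b k}" using assms by force
    then show ?thesis by simp
  next
    case False
    then have *: "{j \<in> U. f j \<le> b k} = U" "U \<subseteq> {j \<in> T. f j \<le> b k}" using assms by force+
    then have "card U \<le> card {j \<in> T. f j \<le> b k}" using assms(1) by (intro card_mono) auto
    then show ?thesis using k * by auto
  qed
qed

lemma measurable_avoids_barrier: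
  assumes "finite U"
  shows "Measurable.pred (\<Pi>\<^sub>M j\<in>U. borel) (avoids_barrier b U)"
proof -
  have [measurable]: "(\<lambda>f. card {j \<in> U. f j \<le> b k}) \<in> measurable (\<Pi>\<^sub>M j\<in>U. borel) (count_space UNIV)" for k
  proof (rule measurable_card)
    fix i
    show "{f \<in> space (\<Pi>\<^sub>M j\<in>U. borel). i \<in> {j \<in> U. f j \<le> b k}} \<in> sets (\<Pi>\<^sub>M j\<in>U. borel)"
    proof (cases "i \<in> U")
      case True
      then have [measurable]: "(\<lambda>f. f i) \<in> borel_measurable (\<Pi>\<^sub>M j\<in>U. borel)" by simp
      show ?thesis using True by simp
    qed simp
  qed
  show ?thesis unfolding avoids_barrier_def[abs_def] by measurable
qed

section \<open>Independent uniform variables\<close>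

lemma sum_over_subsets_by_card:
  fixes g :: "nat \<Rightarrow> real"
  assumes "finite T"
  shows "(\<Sum>U\<in>Pow T. g (card U)) = (\<Sum>k\<le>card T. real (card T choose k) * g k)"
proof -
  have "(\<Sum>U\<in>Pow T. g (card U)) = (\<Sum>k\<le>card T. \<Sum>U\<in>{U \<in> Pow T. card U = k}. g (card U))"
    using assms by (intro sum.group[symmetric]) (auto intro: card_mono)
  also have "\<dots> = (\<Sum>k\<le>card T. real (card T choose k) * g k)"
    using n_subsets[OF assms] by (intro sum.cong refl) simp
  finally show ?thesis .
qed

locale iid_uniform = prob_space +
  fixes P :: "nat \<Rightarrow> 'a \<Rightarrow> real" and I :: "nat set"
  assumes finite_index: "finite I"
    and indep: "indep_vars (\<lambda>_. borel) P I"
    and uniform: "\<And>i. i \<in> I \<Longrightarrow> distr M borel (P i) = uniform_measure lborel {0..1}"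
begin

lemma measurable_P [measurable (raw)]: "i \<in> I \<Longrightarrow> P i \<in> borel_measurable M"
  using indep by (auto simp: indep_vars_def)

lemma measurable_count [measurable]:
  assumes "J \<subseteq> I" "A \<in> sets borel"
  shows "(\<lambda>\<omega>. card {j \<in> J. P j \<omega> \<in> A}) \<in> measurable M (count_space UNIV)"
proof (rule measurable_card)
  fix i
  show "{\<omega> \<in> space M. i \<in> {j \<in> J. P j \<omega> \<in> A}} \<in> sets M"
  proof (cases "i \<in> J")
    case True
    then have "i \<in> I" using assms by auto
    then show ?thesis using True assms by simp
  qed simp
qed

lemma prob_P_in:
  assumes "i \<in> I" "A \<in> sets borel"
  shows "prob (P i -` A \<inter> space M) = measure lborel ({0..1} \<inter> A)"
proof -
  have "prob (P i -` A \<inter> space M) = measure (uniform_measure lborel {0..1}) A"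
    using assms by (simp add: uniform[symmetric] measure_distr)
  also have "\<dots> = measure lborel ({0..1} \<inter> A)"
    using assms by (subst measure_uniform_measure) auto
  finally show ?thesis .
qed

lemma prob_all_in_interval:
  assumes "J \<subseteq> I" "0 \<le> s" "s \<le> t" "t \<le> 1"
  shows "prob {\<omega> \<in> space M. \<forall>j\<in>J. P j \<omega> \<in> {s<..t}} = (t - s) ^ card J"
proof (cases "J = {}")
  case False
  have "finite J" using assms(1) finite_index finite_subset by auto
  have "{\<omega> \<in> space M. \<forall>j\<in>J. P j \<omega> \<in> {s<..t}} = (\<Inter>j\<in>J. P j -` {s<..t} \<inter> space M)"
    using False by auto
  also have "prob \<dots> = (\<Prod>j\<in>J. prob (P j -` {s<..t} \<inter> space M))"
    using False \<open>finite J\<close> assms(1) by (intro indep_varsD[OF indep]) auto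
  also have "\<dots> = (\<Prod>j\<in>J. t - s)"
  proof (rule prod.cong)
    fix j assume "j \<in> J"
    have "{0..1} \<inter> {s<..t} = {s<..t}" using assms by auto
    then show "prob (P j -` {s<..t} \<inter> space M) = t - s"
      using prob_P_in[of j "{s<..t}"] \<open>j \<in> J\<close> assms by auto
  qed simp
  finally show ?thesis by simp
qed (simp add: prob_space)

text \<open>
  Events that look at disjoint sets of the variables are independent.
\<close>

lemma prob_indep_restrict:
  assumes "U \<subseteq> I" "V \<subseteq> I" "U \<inter> V = {}"
    and "Measurable.pred (\<Pi>\<^sub>M j\<in>U. borel) R" "Measurable.pred (\<Pi>\<^sub>M j\<in>V. borel) S"
  shows "prob {\<omega> \<in> space M. R (\<lambda>j\<in>U. P j \<omega>) \<and> S (\<lambda>j\<in>V. P j \<omega>)}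
    = prob {\<omega> \<in> space M. R (\<lambda>j\<in>U. P j \<omega>)} * prob {\<omega> \<in> space M. S (\<lambda>j\<in>V. P j \<omega>)}"
proof -
  let ?A = "{f \<in> space (\<Pi>\<^sub>M j\<in>U. borel). R f}" and ?B = "{f \<in> space (\<Pi>\<^sub>M j\<in>V. borel). S f}"
  have sp: "(\<lambda>j\<in>W. P j \<omega>) \<in> space (\<Pi>\<^sub>M j\<in>W. borel)" for W \<omega> by (auto simp: space_PiM)
  have "?A \<in> sets (\<Pi>\<^sub>M j\<in>U. borel)" "?B \<in> sets (\<Pi>\<^sub>M j\<in>V. borel)"
    using assms(4,5) by (auto simp: pred_def)
  from indep_varD[OF indep_var_restrict[OF indep assms(3,1,2)] this]
  show ?thesis using sp by (simp add: vimage_def Int_def conj_commute)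
qed

text \<open>
  Partition by the set \<open>U\<close> of the indices whose value is at most \<open>s\<close>. If the event depends, given \<open>U\<close>,
  on the values in \<open>U\<close> only, the remaining values are independent of it and each falls between \<open>s\<close>
  and \<open>t\<close> with probability \<open>t - s\<close>.
\<close>

lemma
  assumes "T \<subseteq> I" "0 \<le> s" "s \<le> t" "t \<le> 1"
    and R: "\<And>U. U \<subseteq> T \<Longrightarrow> Measurable.pred (\<Pi>\<^sub>M j\<in>U. borel) (R U)"
    and R_restrict: "\<And>U f. U \<subseteq> T \<Longrightarrow> R U (restrict f U) \<longleftrightarrow> R U f"
  shows prob_split_at:
    "prob {\<omega> \<in> space M. (\<forall>j\<in>T. P j \<omega> \<le> t) \<and> R {j \<in> T. P j \<omega> \<le> s} (\<lambda>j. P j \<omega>)}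
    = (\<Sum>U\<in>Pow T. prob {\<omega> \<in> space M. (\<forall>j\<in>U. P j \<omega> \<le> s) \<and> R U (\<lambda>j. P j \<omega>)}
        * (t - s) ^ (card T - card U))"
    and events_split_at:
    "{\<omega> \<in> space M. (\<forall>j\<in>T. P j \<omega> \<le> t) \<and> R {j \<in> T. P j \<omega> \<le> s} (\<lambda>j. P j \<omega>)} \<in> events"
proof -
  have "finite T" using assms(1) finite_index finite_subset by auto
  define below where "below U f \<longleftrightarrow> (\<forall>j\<in>U. f j \<le> s) \<and> R U f" for U f
  define above where "above V f \<longleftrightarrow> (\<forall>j\<in>V. f j \<in> {s<..t})" for V and f :: "nat \<Rightarrow> real"
  define E where "E U = {\<omega> \<in> space M. below U (\<lambda>j\<in>U. P j \<omega>) \<and> above (T - U) (\<lambda>j\<in>T - U. P j \<omega>)}" for U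
  have below: "Measurable.pred (\<Pi>\<^sub>M j\<in>U. borel) (below U)" if "U \<subseteq> T" for U
  proof -
    have [measurable]: "Measurable.pred (\<Pi>\<^sub>M j\<in>U. borel) (R U)" by (rule R[OF that])
    have "finite U" using that \<open>finite T\<close> finite_subset by auto
    then show ?thesis unfolding below_def[abs_def] by measurable
  qed
  have above: "Measurable.pred (\<Pi>\<^sub>M j\<in>V. borel) (above V)" if "V \<subseteq> T" for V
  proof -
    have "finite V" using that \<open>finite T\<close> finite_subset by auto
    then show ?thesis unfolding above_def[abs_def] by measurable
  qed
  have E_eq: "E U = {\<omega> \<in> space M. (\<forall>j\<in>T. P j \<omega> \<le> t) \<and> {j \<in> T. P j \<omega> \<le> s} = U \<and> R U (\<lambda>j. P j \<omega>)}"
    if "U \<subseteq> T" for U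
    using that assms(3) by (force simp: E_def below_def above_def R_restrict)
  have sets_E: "E U \<in> events" if "U \<subseteq> T" for U
  proof -
    have r: "(\<lambda>\<omega>. \<lambda>j\<in>V. P j \<omega>) \<in> measurable M (\<Pi>\<^sub>M j\<in>V. borel)" if "V \<subseteq> T" for V
      using that assms(1) by (intro measurable_restrict measurable_P) auto
    have [measurable]: "Measurable.pred M (\<lambda>\<omega>. below U (\<lambda>j\<in>U. P j \<omega>))"
      by (rule measurable_compose[OF r below]) (use that in auto)
    have [measurable]: "Measurable.pred M (\<lambda>\<omega>. above (T - U) (\<lambda>j\<in>T - U. P j \<omega>))"
      by (rule measurable_compose[OF r above]) auto
    show ?thesis unfolding E_def by measurable
  qed
  have cells: "{\<omega> \<in> space M. (\<forall>j\<in>T. P j \<omega> \<le> t) \<and> R {j \<in> T. P j \<omega> \<le> s} (\<lambda>j. P j \<omega>)}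
      = (\<Union>U\<in>Pow T. E U)"
    using E_eq by auto
  show "{\<omega> \<in> space M. (\<forall>j\<in>T. P j \<omega> \<le> t) \<and> R {j \<in> T. P j \<omega> \<le> s} (\<lambda>j. P j \<omega>)} \<in> events"
    unfolding cells using \<open>finite T\<close> sets_E by auto
  have "prob (\<Union>U\<in>Pow T. E U) = (\<Sum>U\<in>Pow T. prob (E U))"
    using \<open>finite T\<close> sets_E
    by (intro finite_measure_finite_Union) (auto simp: disjoint_family_on_def E_eq)
  also have "\<dots> = (\<Sum>U\<in>Pow T. prob {\<omega> \<in> space M. (\<forall>j\<in>U. P j \<omega> \<le> s) \<and> R U (\<lambda>j. P j \<omega>)}
      * (t - s) ^ (card T - card U))"
  proof (rule sum.cong[OF refl])
    fix U assume "U \<in> Pow T"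
    then have U: "U \<subseteq> T" by simp
    have "prob (E U) = prob {\<omega> \<in> space M. below U (\<lambda>j\<in>U. P j \<omega>)}
        * prob {\<omega> \<in> space M. above (T - U) (\<lambda>j\<in>T - U. P j \<omega>)}"
      unfolding E_def by (rule prob_indep_restrict[OF _ _ _ below above]) (use U assms(1) in auto)
    also have "prob {\<omega> \<in> space M. above (T - U) (\<lambda>j\<in>T - U. P j \<omega>)} = (t - s) ^ card (T - U)"
      using prob_all_in_interval[of "T - U" s t] assms(1-4) by (auto simp: above_def)
    also have "card (T - U) = card T - card U"
      using U \<open>finite T\<close> by (metis card_Diff_subset finite_subset)
    also have "{\<omega> \<in> space M. below U (\<lambda>j\<in>U. P j \<omega>)}
        = {\<omega> \<in> space M. (\<forall>j\<in>U. P j \<omega> \<le> s) \<and> R U (\<lambda>j. P j \<omega>)}"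
      unfolding below_def R_restrict[OF U] by simp
    finally show "prob (E U) = prob {\<omega> \<in> space M. (\<forall>j\<in>U. P j \<omega> \<le> s) \<and> R U (\<lambda>j. P j \<omega>)}
        * (t - s) ^ (card T - card U)" .
  qed
  finally show "prob {\<omega> \<in> space M. (\<forall>j\<in>T. P j \<omega> \<le> t) \<and> R {j \<in> T. P j \<omega> \<le> s} (\<lambda>j. P j \<omega>)}
    = (\<Sum>U\<in>Pow T. prob {\<omega> \<in> space M. (\<forall>j\<in>U. P j \<omega> \<le> s) \<and> R U (\<lambda>j. P j \<omega>)}
        * (t - s) ^ (card T - card U))"
    unfolding cells .
qed

text \<open>
  Induction on the number \<open>n\<close> of variables, by a split at \<open>s = b n\<close>. Not all values can be at most \<open>s\<close>,
  and if \<open>U\<close> is the set of those that are, then avoiding the barrier means avoiding it with \<open>U\<close>: the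
  constraints with \<open>k > card U\<close> hold because \<open>b k \<le> s\<close>. The sum over \<open>U\<close> is therefore the Taylor
  expansion of the \<open>n\<close>-th polynomial at \<open>s\<close>; the term for \<open>U = T\<close>, which does not occur in the
  probability, vanishes in the expansion because \<open>s\<close> is a zero of that polynomial.
\<close>

lemma prob_avoids_barrier:
  assumes "T \<subseteq> I" "mono_on {1..card I} b" "\<And>k. k \<in> {1..card I} \<Longrightarrow> 0 \<le> b k"
    and a: "a 0 = 1" "\<And>k. k \<in> {1..card I} \<Longrightarrow> appell a k (b k) = 0"
    and "0 \<le> t" "t \<le> 1" "T \<noteq> {} \<Longrightarrow> b (card T) \<le> t"
  shows "prob {\<omega> \<in> space M. (\<forall>j\<in>T. P j \<omega> \<le> t) \<and> avoids_barrier b T (\<lambda>j. P j \<omega>)}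
    = fact (card T) * appell a (card T) t"
  using assms(1,6-)
proof (induction "card T" arbitrary: T t rule: less_induct)
  case (less T t)
  have "finite T" using less.prems(1) finite_index finite_subset by auto
  show ?case
  proof (cases "T = {}")
    case True
    then show ?thesis using a(1) by (simp add: avoids_barrier_def appell_def prob_space)
  next
    case False
    define n where "n = card T"
    define s where "s = b n"
    have n: "n \<in> {1..card I}"
      using False \<open>finite T\<close> card_mono[OF finite_index less.prems(1)]
      by (auto simp: n_def Suc_le_eq card_gt_0_iff)
    have s: "0 \<le> s" "s \<le> t" using assms(3)[OF n] less.prems(4) False by (auto simp: s_def n_def)
    have zero: "appell a n s = 0" using a(2)[OF n] by (simp add: s_def)
    \<comment> \<open>If \<open>U = T\<close>, then all \<open>n\<close> values are at most \<open>b n\<close>, which violates the last constraint.\<close>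
    define R where "R U f \<longleftrightarrow> U \<noteq> T \<and> avoids_barrier b U f" for U f
    have avoid: "avoids_barrier b T f \<longleftrightarrow> R {j \<in> T. f j \<le> s} f" for f
    proof -
      let ?U = "{j \<in> T. f j \<le> s}"
      have card_U: "card ?U \<le> n" using \<open>finite T\<close> by (auto simp: n_def intro: card_mono)
      have "(\<forall>k\<in>{1..card ?U}. card {j \<in> T. f j \<le> b k} < k) \<longleftrightarrow> avoids_barrier b ?U f"
        by (rule avoids_barrier_split[OF \<open>finite T\<close>]) auto
      moreover have "avoids_barrier b T f \<longleftrightarrow>
          ?U \<noteq> T \<and> (\<forall>k\<in>{1..card ?U}. card {j \<in> T. f j \<le> b k} < k)"
      proof (intro iffI conjI)
        assume "avoids_barrier b T f"
        then have "card ?U < n" using n by (auto simp: avoids_barrier_def s_def n_def)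
        then show "?U \<noteq> T" by (auto simp: n_def)
      next
        assume "avoids_barrier b T f"
        then show "\<forall>k\<in>{1..card ?U}. card {j \<in> T. f j \<le> b k} < k"
          using card_U by (auto simp: avoids_barrier_def n_def)
      next
        assume "?U \<noteq> T \<and> (\<forall>k\<in>{1..card ?U}. card {j \<in> T. f j \<le> b k} < k)"
        then have low: "\<forall>k\<in>{1..card ?U}. card {j \<in> T. f j \<le> b k} < k" by simp
        show "avoids_barrier b T f" unfolding avoids_barrier_def
        proof
          fix k assume k: "k \<in> {1..card T}"
          show "card {j \<in> T. f j \<le> b k} < k"
          proof (cases "k \<le> card ?U")
            case False
            have "b k \<le> s" using k n unfolding s_def n_def
              by (intro mono_onD[OF assms(2)]) auto
            then have "card {j \<in> T. f j \<le> b k} \<le> card ?U"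
              using \<open>finite T\<close> by (intro card_mono) auto
            then show ?thesis using False by simp
          qed (use low k in auto)
        qed
      qed
      ultimately show ?thesis by (simp add: R_def)
    qed
    have low: "prob {\<omega> \<in> space M. (\<forall>j\<in>U. P j \<omega> \<le> s) \<and> R U (\<lambda>j. P j \<omega>)}
        = fact (card U) * appell a (card U) s" if "U \<subseteq> T" for U
    proof (cases "U = T")
      case True
      then show ?thesis using zero by (simp add: R_def n_def)
    next
      case False
      then have lt: "card U < card T" using that \<open>finite T\<close> by (simp add: psubset_card_mono psubsetI)
      have "finite U" using that \<open>finite T\<close> finite_subset by auto
      have "b (card U) \<le> s" if "U \<noteq> {}"
        using that lt n \<open>finite U\<close> unfolding s_def n_def
        by (intro mono_onD[OF assms(2)]) (auto simp: Suc_le_eq card_gt_0_iff)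
      then show ?thesis
        using less.hyps[OF lt, of s] False that less.prems s by (auto simp: R_def)
    qed
    have "prob {\<omega> \<in> space M. (\<forall>j\<in>T. P j \<omega> \<le> t) \<and> avoids_barrier b T (\<lambda>j. P j \<omega>)}
        = (\<Sum>U\<in>Pow T. prob {\<omega> \<in> space M. (\<forall>j\<in>U. P j \<omega> \<le> s) \<and> R U (\<lambda>j. P j \<omega>)}
            * (t - s) ^ (card T - card U))"
      unfolding avoid
    proof (rule prob_split_at)
      fix U assume "U \<subseteq> T"
      then have "finite U" using \<open>finite T\<close> finite_subset by auto
      then have [measurable]: "Measurable.pred (\<Pi>\<^sub>M j\<in>U. borel) (avoids_barrier b U)"
        by (rule measurable_avoids_barrier)
      show "Measurable.pred (\<Pi>\<^sub>M j\<in>U. borel) (R U)" unfolding R_def[abs_def] by measurable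
    next
      show "R U (restrict f U) \<longleftrightarrow> R U f" for U f
        unfolding R_def avoids_barrier_restrict ..
    qed (use s less.prems in auto)
    also have "\<dots> = (\<Sum>U\<in>Pow T. fact (card U) * appell a (card U) s * (t - s) ^ (n - card U))"
      using low by (intro sum.cong) (auto simp: n_def)
    also have "\<dots> = (\<Sum>k\<le>n. real (n choose k) * (fact k * appell a k s * (t - s) ^ (n - k)))"
      using sum_over_subsets_by_card[OF \<open>finite T\<close>, of "\<lambda>k. fact k * appell a k s * (t - s) ^ (n - k)"]
      by (simp add: n_def)
    also have "\<dots> = fact n * (\<Sum>k\<le>n. appell a k s * (t - s) ^ (n - k) / fact (n - k))"
      unfolding sum_distrib_left by (intro sum.cong refl) (simp add: binomial_fact)
    also have "\<dots> = fact n * appell a n t" by (simp add: appell_shift[symmetric])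
    finally show ?thesis by (simp add: n_def)
  qed
qed

lemma AE_P_notin:
  assumes "i \<in> I" "A \<in> sets borel" "measure lborel ({0..1} \<inter> A) = 0"
  shows "AE \<omega> in M. P i \<omega> \<notin> A"
proof (rule AE_I)
  show "{\<omega> \<in> space M. \<not> P i \<omega> \<notin> A} \<subseteq> P i -` A \<inter> space M" by auto
  show "emeasure M (P i -` A \<inter> space M) = 0"
    using prob_P_in[OF assms(1,2)] assms(3) by (simp add: emeasure_eq_measure)
  show "P i -` A \<inter> space M \<in> events"
    using assms by (intro measurable_sets[OF measurable_P]) auto
qed

lemma AE_all_P_le_1: "AE \<omega> in M. \<forall>i\<in>I. P i \<omega> \<le> 1"
proof -
  have "AE \<omega> in M. P i \<omega> \<notin> {1<..}" if "i \<in> I" for i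
  proof (rule AE_P_notin[OF that])
    have "{0..1} \<inter> {1<..} = ({} :: real set)" by auto
    then show "measure lborel ({0..1} \<inter> {1<..} :: real set) = 0" by simp
  qed simp
  then have "AE \<omega> in M. \<forall>i\<in>I. P i \<omega> \<notin> {1<..}" by (simp add: AE_finite_all finite_index)
  then show ?thesis by (simp add: not_less)
qed

lemma AE_all_P_neq: "AE \<omega> in M. \<forall>i\<in>I. P i \<omega> \<noteq> t"
proof -
  have "AE \<omega> in M. P i \<omega> \<notin> {t}" if "i \<in> I" for i
    by (rule AE_P_notin[OF that]) (auto simp: Int_insert_right)
  then have "AE \<omega> in M. \<forall>i\<in>I. P i \<omega> \<notin> {t}" by (simp add: AE_finite_all finite_index)
  then show ?thesis by simp
qed

end

section \<open>The recursions as Goncarov polynomials\<close>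

text \<open>
  The coefficient with index \<open>0\<close> is the leading \<open>1\<close> in the vector to which the recursion applies the
  polynomials; the vector is shifted by one against the index of its entries.
\<close>

definition Q_bar_coeff :: "(nat \<Rightarrow> real) \<Rightarrow> nat \<Rightarrow> nat \<Rightarrow> real" where
  "Q_bar_coeff q c j = (if j = 0 then 1 else - Q_bar q c j)"

text \<open>
  The vector ends with index \<open>i - 1\<close>, so the constant term of the Appell polynomial is the only one
  missing.
\<close>

lemma Q_poly_eq_appell:
  assumes "1 \<le> i"
  shows "Q_poly i y (1 # map (\<lambda>j. - Q_bar q c j) [1..<i]) = appell (Q_bar_coeff q c) i y + Q_bar q c i"
proof -
  let ?as = "1 # map (\<lambda>j. - Q_bar q c j) [1..<i]"
  have "Q_poly i y ?as = (\<Sum>j<i. ?as ! j / fact (i - j) * y ^ (i - j))"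
    unfolding Q_poly_def
    by (rule sum.reindex_bij_witness[where i = Suc and j = "\<lambda>j. j - 1"]) auto
  also have "\<dots> = (\<Sum>j<i. Q_bar_coeff q c j * y ^ (i - j) / fact (i - j))"
    by (intro sum.cong refl) (auto simp: Q_bar_coeff_def nth_Cons split: nat.split)
  also have "\<dots> = appell (Q_bar_coeff q c) i y + Q_bar q c i"
    using assms by (simp add: appell_Suc Q_bar_coeff_def)
  finally show ?thesis .
qed

lemma Q_bar_1: "Q_bar q c 1 = q 1"
  by (subst Q_bar.simps) simp

text \<open>
  The recursion for \<open>Q_bar\<close> chooses the constant term such that the \<open>i\<close>-th polynomial vanishes at the
  \<open>i\<close>-th barrier point.
\<close>

lemma appell_Q_bar_zero:
  assumes "1 \<le> i" "1 \<le> c"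
  shows "appell (Q_bar_coeff q c) i (q (min i c)) = 0"
proof (cases "i = 1")
  case True
  then show ?thesis
    using assms Q_bar_1[of q c] by (simp add: appell_def Q_bar_coeff_def)
next
  case False
  then have "Q_bar q c i = Q_poly i (q (min i c)) (1 # map (\<lambda>j. - Q_bar q c j) [1..<i])"
    using assms by (subst Q_bar.simps) simp
  then show ?thesis using Q_poly_eq_appell[OF assms(1), of "q (min i c)" q c] by linarith
qed

lemma Q_tilde_minus_Q_bar:
  assumes "1 \<le> i"
  shows "Q_tilde q m \<tau> i - Q_bar q m i = appell (Q_bar_coeff q m) i \<tau>"
proof (cases "i = 1")
  case True
  then show ?thesis by (simp add: appell_def Q_bar_coeff_def Q_tilde_def)
next
  case False
  then show ?thesis
    using assms Q_poly_eq_appell[of i \<tau> q m] by (simp add: Q_tilde_def)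
qed

section \<open>The distribution of the test statistic\<close>

locale order_stat_quantiles = iid_uniform M P "{1..m}" for M and P and m :: nat +
  fixes x :: real and q :: "nat \<Rightarrow> real"
  assumes m_pos: "1 \<le> m" and x_pos: "0 < x" and x_less_1: "x < 1"
    and quantile: "\<And>i. i \<in> {1..m} \<Longrightarrow> beta_cdf (real i) (real (m + 1 - i)) (q i) = x"
begin

lemma q_pos: "i \<in> {1..m} \<Longrightarrow> 0 < q i"
  and q_less_1: "i \<in> {1..m} \<Longrightarrow> q i < 1"
  using beta_quantile(1,2)[OF _ _ x_pos x_less_1 quantile[of i]] by auto

lemma q_mono:
  assumes "1 \<le> i" "i \<le> k" "k \<le> m"
  shows "q i \<le> q k"
  using quantile_strict_mono[OF assms(1) _ assms(3) x_pos x_less_1 quantile quantile] assms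
  by (cases "i = k") (auto intro: less_imp_le)

lemma x_eq_q_1: "x = 1 - (1 - q 1) ^ m"
  using beta_quantile(3)[OF _ _ x_pos x_less_1 quantile[of 1]] m_pos binomial_tail_from_1 by simp

text \<open>
  The passage from sorting to counting also gives the measurability of the event, since counts of
  measurable events are measurable, for a fixed and for a random cutoff alike.
\<close>

lemma gamma_inf_eq_survival:
  assumes [measurable]: "c \<in> measurable M (count_space UNIV)" and c: "\<And>\<omega>. c \<omega> \<in> {1..m}"
  shows "gamma_inf M m P c x
    = 1 - prob {\<omega> \<in> space M. \<forall>k\<in>{1..c \<omega>}. card {j \<in> {1..m}. P j \<omega> \<le> q k} < k}"
    (is "_ = 1 - prob ?S")
    and "{\<omega> \<in> space M. \<forall>k\<in>{1..c \<omega>}. card {j \<in> {1..m}. P j \<omega> \<le> q k} < k} \<in> events"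
proof -
  have [measurable]: "(\<lambda>\<omega>. card {j \<in> {1..m}. P j \<omega> \<le> t}) \<in> measurable M (count_space UNIV)" for t
    using measurable_count[of "{1..m}" "{..t}"] by simp
  have "?S = {\<omega> \<in> space M. \<forall>k\<in>{1..m}. k \<le> c \<omega> \<longrightarrow> card {j \<in> {1..m}. P j \<omega> \<le> q k} < k}"
    using c by (fastforce intro: order_trans)
  also have "\<dots> \<in> events" by measurable
  finally show S: "?S \<in> events" .
  have "Z_inf m (c \<omega>) (\<lambda>i. P i \<omega>) \<le> x
      \<longleftrightarrow> (\<exists>k\<in>{1..c \<omega>}. k \<le> card {j \<in> {1..m}. P j \<omega> \<le> q k})" for \<omega>
    using c[of \<omega>] by (intro Z_inf_le_iff[OF _ _ x_pos x_less_1 quantile]) auto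
  then have "{\<omega> \<in> space M. Z_inf m (c \<omega>) (\<lambda>i. P i \<omega>) \<le> x} = space M - ?S"
    unfolding not_less[symmetric] by blast
  then show "gamma_inf M m P c x = 1 - prob ?S"
    unfolding gamma_inf_def by (simp only: prob_compl[OF S])
qed

text \<open>
  Freezing the barrier at \<open>q c\<close> beyond index \<open>c\<close> adds no constraint, as \<open>P\<^sub>(\<^sub>k\<^sub>) \<ge> P\<^sub>(\<^sub>c\<^sub>)\<close> for \<open>k \<ge> c\<close>. All \<open>m\<close>
  variables then have to avoid the barrier below \<open>1\<close>. The formula follows by subtracting from the
  value of the \<open>m\<close>-th polynomial at \<open>1\<close> its value at \<open>q c\<close>, which is zero; this cancels the constant term.
\<close>

lemma gamma_inf_fixed:
  assumes c: "c \<in> {1..m}"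
  shows "gamma_inf M m P (\<lambda>_. c) x
    = q c ^ m + (\<Sum>i = 1..m - 1. fact m / fact (m - i) * Q_bar q c i * (1 - q c ^ (m - i)))"
proof -
  let ?a = "Q_bar_coeff q c" and ?b = "\<lambda>k. q (min k c)"
  let ?S = "{\<omega> \<in> space M. \<forall>k\<in>{1..c}. card {j \<in> {1..m}. P j \<omega> \<le> q k} < k}"
  let ?E = "{\<omega> \<in> space M. (\<forall>j\<in>{1..m}. P j \<omega> \<le> 1) \<and> avoids_barrier ?b {1..m} (\<lambda>j. P j \<omega>)}"
  have avoid: "avoids_barrier ?b {1..m} f \<longleftrightarrow> (\<forall>k\<in>{1..c}. card {j \<in> {1..m}. f j \<le> q k} < k)" for f
  proof
    assume "avoids_barrier ?b {1..m} f"
    then have *: "card {j \<in> {1..m}. f j \<le> q (min k c)} < k" if "k \<in> {1..m}" for k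
      using that by (simp add: avoids_barrier_def)
    show "\<forall>k\<in>{1..c}. card {j \<in> {1..m}. f j \<le> q k} < k"
    proof
      fix k assume "k \<in> {1..c}"
      then have "min k c = k" "k \<in> {1..m}" using c by auto
      then show "card {j \<in> {1..m}. f j \<le> q k} < k" using *[of k] by simp
    qed
  next
    assume *: "\<forall>k\<in>{1..c}. card {j \<in> {1..m}. f j \<le> q k} < k"
    show "avoids_barrier ?b {1..m} f" unfolding avoids_barrier_def
    proof
      fix k assume "k \<in> {1..card {1..m}}"
      then have "min k c \<in> {1..c}" using c by auto
      from *[rule_format, OF this] have "card {j \<in> {1..m}. f j \<le> q (min k c)} < min k c" .
      then show "card {j \<in> {1..m}. f j \<le> q (min k c)} < k" by simp
    qed
  qed
  have "AE \<omega> in M. \<omega> \<in> ?S \<longleftrightarrow> \<omega> \<in> ?E"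
    using AE_all_P_le_1 by eventually_elim (simp add: avoid del: One_nat_def)
  moreover have "?S \<in> events" using gamma_inf_eq_survival(2)[of "\<lambda>_. c"] c by simp
  moreover have "?E \<in> events"
  proof -
    have "?E = ?S \<inter> (\<Inter>j\<in>{1..m}. {\<omega> \<in> space M. P j \<omega> \<le> 1})"
      using m_pos by (auto simp: avoid simp del: One_nat_def)
    then show ?thesis using \<open>?S \<in> events\<close> m_pos by auto
  qed
  ultimately have "prob ?S = prob ?E" by (rule finite_measure_eq_AE)
  also have "\<dots> = fact m * appell ?a m 1"
  proof -
    have "prob ?E = fact (card {1..m}) * appell ?a (card {1..m}) 1"
    proof (rule prob_avoids_barrier)
      show "mono_on {1..card {1..m}} ?b" using c by (auto intro!: mono_onI q_mono)
      show "0 \<le> ?b k" if "k \<in> {1..card {1..m}}" for k using q_pos[of k] q_pos[of c] that c by (auto simp: min_def)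
      show "appell ?a k (?b k) = 0" if "k \<in> {1..card {1..m}}" for k
        using that c by (intro appell_Q_bar_zero) auto
      show "?b (card {1..m}) \<le> 1" using q_less_1[of c] c by simp
    qed (auto simp: Q_bar_coeff_def)
    then show ?thesis by simp
  qed
  finally have "gamma_inf M m P (\<lambda>_. c) x = 1 - fact m * (appell ?a m 1 - appell ?a m (q c))"
    using gamma_inf_eq_survival(1)[of "\<lambda>_. c"] appell_Q_bar_zero[of m c q] c m_pos
    by (simp add: min_absorb2)
  also have "appell ?a m 1 - appell ?a m (q c) = (\<Sum>i\<le>m. ?a i * (1 - q c ^ (m - i)) / fact (m - i))"
    by (simp add: appell_def sum_subtractf[symmetric] algebra_simps diff_divide_distrib)
  also have "{..m} = insert 0 (insert m {1..m - 1})" using m_pos by auto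
  also have "(\<Sum>i\<in>insert 0 (insert m {1..m - 1}). ?a i * (1 - q c ^ (m - i)) / fact (m - i))
      = (1 - q c ^ m) / fact m - (\<Sum>i = 1..m - 1. Q_bar q c i * (1 - q c ^ (m - i)) / fact (m - i))"
    using m_pos by (simp add: Q_bar_coeff_def sum_negf[symmetric])
  also have "1 - fact m * ((1 - y) / fact m - z) = y + fact m * z" for y z :: real
    by (simp add: field_simps)
  finally show ?thesis
    by (simp add: sum_distrib_left mult_ac)
qed

text \<open>
  Partition by the set \<open>U\<close> of the indices with \<open>P\<^sub>j \<le> \<tau>\<close>. If \<open>U\<close> is nonempty, the cutoff is its size, only
  the values in \<open>U\<close> are constrained, and they have to avoid the barrier below \<open>\<tau>\<close>; this is impossible
  if the barrier point \<open>q (card U)\<close> exceeds \<open>\<tau>\<close>. If \<open>U\<close> is empty, the cutoff is \<open>1\<close> and the values above \<open>\<tau>\<close> are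
  themselves constrained, so this case is treated separately.
\<close>

lemma gamma_inf_random:
  assumes \<tau>: "0 < \<tau>" "\<tau> < 1"
  shows "gamma_inf M m P (\<lambda>\<omega>. random_cutoff m \<tau> (\<lambda>i. P i \<omega>)) x =
    (1 - \<tau>) ^ m * ((x - beta_cdf 1 (real m) \<tau>) / (1 - beta_cdf 1 (real m) \<tau>)) * of_bool (q 1 > \<tau>)
    + (\<Sum>i = 1..m. real (m choose i) * \<tau> ^ i * (1 - \<tau>) ^ (m - i)
        * (1 - fact i / \<tau> ^ i * (Q_tilde q m \<tau> i - Q_bar q m i) * of_bool (q i \<le> \<tau>)))"
proof -
  let ?T = "{1..m}" and ?a = "Q_bar_coeff q m"
  define c where "c \<omega> = random_cutoff m \<tau> (\<lambda>i. P i \<omega>)" for \<omega>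
  define R where "R U f \<longleftrightarrow> U \<noteq> {} \<and> avoids_barrier q U f" for U f
  define r where "r = max \<tau> (q 1)"
  define g where "g i = (if i \<noteq> 0 \<and> q i \<le> \<tau> then fact i * appell ?a i \<tau> else 0)" for i
  \<comment> \<open>The surviving outcomes split into those without (\<open>?E0\<close>) and with (\<open>?E1\<close>) values up to \<open>\<tau>\<close>.\<close>
  let ?S = "{\<omega> \<in> space M. \<forall>k\<in>{1..c \<omega>}. card {j \<in> ?T. P j \<omega> \<le> q k} < k}"
  let ?E0 = "{\<omega> \<in> space M. \<forall>j\<in>?T. P j \<omega> \<in> {r<..1}}"
  let ?E1 = "{\<omega> \<in> space M. (\<forall>j\<in>?T. P j \<omega> \<le> 1) \<and> R {j \<in> ?T. P j \<omega> \<le> \<tau>} (\<lambda>j. P j \<omega>)}"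
  have [measurable]: "(\<lambda>\<omega>. card {j \<in> {1..m}. P j \<omega> < t}) \<in> measurable M (count_space UNIV)"
      "(\<lambda>\<omega>. card {j \<in> {1..m}. P j \<omega> \<le> t}) \<in> measurable M (count_space UNIV)" for t
    using measurable_count[of "{1..m}" "{..<t}"] measurable_count[of "{1..m}" "{..t}"] by simp_all
  have le_m: "card {j \<in> {1..m}. A j} \<le> m" for A
  proof -
    have "card {j \<in> {1..m}. A j} \<le> card {1..m}" by (intro card_mono) auto
    then show ?thesis by simp
  qed
  have c_meas: "c \<in> measurable M (count_space UNIV)"
    unfolding c_def[abs_def] random_cutoff_eq
    by (rule measurable_compose[where N = "count_space UNIV" and g = "max 1"]) auto
  have c_range: "c \<omega> \<in> {1..m}" for \<omega>
    using le_m m_pos by (auto simp: c_def random_cutoff_eq)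
  have S_events: "?S \<in> events" by (rule gamma_inf_eq_survival(2)[OF c_meas c_range])
  have E0_low: "{j \<in> ?T. P j \<omega> \<le> \<tau>} = {}" if "\<omega> \<in> ?E0" for \<omega>
  proof -
    have "\<not> P j \<omega> \<le> \<tau>" if "j \<in> ?T" for j
    proof -
      have "P j \<omega> \<in> {r<..1}" using \<open>\<omega> \<in> ?E0\<close> that by blast
      then show ?thesis by (simp add: r_def)
    qed
    then show ?thesis by blast
  qed
  have cases: "\<omega> \<in> ?S \<longleftrightarrow> \<omega> \<in> ?E0 \<union> ?E1"
    if le_1: "\<forall>j\<in>?T. P j \<omega> \<le> 1" and neq: "\<forall>j\<in>?T. P j \<omega> \<noteq> \<tau>" and "\<omega> \<in> space M" for \<omega>
  proof (cases "{j \<in> ?T. P j \<omega> \<le> \<tau>} = {}")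
    case True
    then have above: "\<forall>j\<in>?T. \<tau> < P j \<omega>" by force
    then have "{j \<in> ?T. P j \<omega> < \<tau>} = {}" by force
    then have "c \<omega> = 1" by (simp add: c_def random_cutoff_eq)
    then have "\<omega> \<in> ?S \<longleftrightarrow> {j \<in> ?T. P j \<omega> \<le> q 1} = {}" using that(3) by simp
    also have "\<dots> \<longleftrightarrow> (\<forall>j\<in>?T. q 1 < P j \<omega>)" unfolding not_le[symmetric] by blast
    also have "\<dots> \<longleftrightarrow> \<omega> \<in> ?E0" using above le_1 that(3) by (auto simp: r_def)
    also have "\<dots> \<longleftrightarrow> \<omega> \<in> ?E0 \<union> ?E1" using True by (auto simp: R_def)
    finally show ?thesis .
  next
    case False
    let ?U = "{j \<in> ?T. P j \<omega> \<le> \<tau>}"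
    have "{j \<in> ?T. P j \<omega> < \<tau>} = ?U" using neq by force
    moreover have "1 \<le> card ?U" using False by (simp add: Suc_le_eq card_gt_0_iff)
    ultimately have "c \<omega> = card ?U" unfolding c_def random_cutoff_eq by simp
    then have "\<omega> \<in> ?S \<longleftrightarrow> (\<forall>k\<in>{1..card ?U}. card {j \<in> ?T. P j \<omega> \<le> q k} < k)"
      using that(3) by simp
    also have "\<dots> \<longleftrightarrow> avoids_barrier q ?U (\<lambda>j. P j \<omega>)"
      by (rule avoids_barrier_split[where s = \<tau>]) auto
    also have "\<dots> \<longleftrightarrow> \<omega> \<in> ?E1" using False le_1 that(3) by (simp add: R_def)
    also have "\<dots> \<longleftrightarrow> \<omega> \<in> ?E0 \<union> ?E1" using False E0_low by blast
    finally show ?thesis .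
  qed
  have E0_events: "?E0 \<in> events"
  proof -
    have "?E0 = (\<Inter>j\<in>?T. P j -` {r<..1} \<inter> space M)" using m_pos by auto
    also have "\<dots> \<in> events"
      using m_pos by (intro sets.finite_INT measurable_sets[OF measurable_P]) auto
    finally show ?thesis .
  qed
  have R_meas: "Measurable.pred (\<Pi>\<^sub>M j\<in>U. borel) (R U)" if "U \<subseteq> ?T" for U
  proof -
    have "finite U" using that finite_subset by auto
    then have "Measurable.pred (\<Pi>\<^sub>M j\<in>U. borel) (avoids_barrier q U)"
      by (rule measurable_avoids_barrier)
    then show ?thesis unfolding R_def[abs_def] by (cases "U = {}") simp_all
  qed
  have R_restrict: "R U (restrict f U) \<longleftrightarrow> R U f" for U f
    unfolding R_def avoids_barrier_restrict ..
  have E1_events: "?E1 \<in> events"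
    by (rule events_split_at[where R = R, OF _ _ _ _ R_meas R_restrict]) (use \<tau> in auto)
  \<comment> \<open>The cutoff counts \<open>P\<^sub>j < \<tau>\<close> but the partition uses \<open>P\<^sub>j \<le> \<tau>\<close>; ties with \<open>\<tau>\<close> form a null set.\<close>
  have "AE \<omega> in M. \<omega> \<in> ?S \<longleftrightarrow> \<omega> \<in> ?E0 \<union> ?E1"
    using AE_all_P_le_1 AE_all_P_neq[of \<tau>] AE_space by eventually_elim (rule cases)
  then have "prob ?S = prob (?E0 \<union> ?E1)"
    by (rule finite_measure_eq_AE[OF _ S_events sets.Un[OF E0_events E1_events]])
  also have "\<dots> = prob ?E0 + prob ?E1"
  proof (rule finite_measure_Union[OF E0_events E1_events])
    have "\<omega> \<notin> ?E1" if "\<omega> \<in> ?E0" for \<omega>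
      using E0_low[OF that] by (simp add: R_def)
    then show "?E0 \<inter> ?E1 = {}" by blast
  qed
  also have "prob ?E0 = (1 - r) ^ m"
  proof -
    have "0 \<le> r" "r \<le> 1" using \<tau> q_less_1[of 1] m_pos by (auto simp: r_def)
    from prob_all_in_interval[OF subset_refl this order_refl] show ?thesis by simp
  qed
  also have "prob ?E1 = (\<Sum>U\<in>Pow ?T. g (card U) * (1 - \<tau>) ^ (m - card U))"
  proof -
    have "prob ?E1 = (\<Sum>U\<in>Pow ?T. prob {\<omega> \<in> space M. (\<forall>j\<in>U. P j \<omega> \<le> \<tau>) \<and> R U (\<lambda>j. P j \<omega>)}
        * (1 - \<tau>) ^ (card ?T - card U))"
      by (rule prob_split_at[where R = R, OF _ _ _ _ R_meas R_restrict]) (use \<tau> in auto)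
    also have "\<dots> = (\<Sum>U\<in>Pow ?T. g (card U) * (1 - \<tau>) ^ (m - card U))"
    proof (intro sum.cong refl arg_cong2[where f = "(*)"])
      fix U assume "U \<in> Pow ?T"
      then have U: "U \<subseteq> ?T" "finite U" "card U \<le> m"
        using finite_subset card_mono[of ?T U] by auto
      show "prob {\<omega> \<in> space M. (\<forall>j\<in>U. P j \<omega> \<le> \<tau>) \<and> R U (\<lambda>j. P j \<omega>)} = g (card U)"
      proof (cases "U = {}")
        case False
        then have U1: "1 \<le> card U" using U by (simp add: Suc_le_eq card_gt_0_iff)
        show ?thesis
        proof (cases "q (card U) \<le> \<tau>")
          case True
          have "prob {\<omega> \<in> space M. (\<forall>j\<in>U. P j \<omega> \<le> \<tau>) \<and> avoids_barrier q U (\<lambda>j. P j \<omega>)}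
              = fact (card U) * appell ?a (card U) \<tau>"
          proof (rule prob_avoids_barrier[OF U(1)])
            show "mono_on {1..card ?T} q" by (auto intro!: mono_onI q_mono)
            show "0 \<le> q k" if "k \<in> {1..card ?T}" for k using q_pos[of k] that by simp
            show "appell ?a k (q k) = 0" if "k \<in> {1..card ?T}" for k
              using that m_pos appell_Q_bar_zero[of k m q] by (simp add: min_def)
          qed (use \<tau> True in \<open>auto simp: Q_bar_coeff_def\<close>)
          then show ?thesis using False True U1 by (simp add: R_def g_def)
        next
          case gt: False
          have "\<not> avoids_barrier q U f" if "\<forall>j\<in>U. f j \<le> \<tau>" for f
          proof -
            have "{j \<in> U. f j \<le> q (card U)} = U" using that gt by force
            then show ?thesis using U1 by (auto simp: avoids_barrier_def intro!: bexI[of _ "card U"])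
          qed
          then have "{\<omega> \<in> space M. (\<forall>j\<in>U. P j \<omega> \<le> \<tau>) \<and> R U (\<lambda>j. P j \<omega>)} = {}"
            by (auto simp: R_def)
          then show ?thesis using gt by (simp only: g_def) simp
        qed
      qed (simp add: R_def g_def)
    qed simp
    finally show ?thesis .
  qed
  also have "\<dots> = (\<Sum>i\<le>m. real (m choose i) * (g i * (1 - \<tau>) ^ (m - i)))"
    using sum_over_subsets_by_card[of ?T "\<lambda>i. g i * (1 - \<tau>) ^ (m - i)"] by simp
  also have "\<dots> = (\<Sum>i = 1..m. real (m choose i) * (g i * (1 - \<tau>) ^ (m - i)))"
    unfolding atMost_atLeast0 by (simp add: sum.atLeast_Suc_atMost g_def)
  finally have "gamma_inf M m P c x
      = 1 - (1 - r) ^ m - (\<Sum>i = 1..m. real (m choose i) * (g i * (1 - \<tau>) ^ (m - i)))"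
    using gamma_inf_eq_survival(1)[OF c_meas c_range] by simp
  also have "1 - (1 - r) ^ m
      = ((1 - \<tau>) ^ m - (1 - q 1) ^ m) * of_bool (q 1 > \<tau>) + binomial_tail m 1 \<tau>"
    unfolding binomial_tail_from_1[OF m_pos] by (simp add: r_def max_def)
  also have "(1 - \<tau>) ^ m - (1 - q 1) ^ m
      = (1 - \<tau>) ^ m * ((x - beta_cdf 1 (real m) \<tau>) / (1 - beta_cdf 1 (real m) \<tau>))"
  proof -
    have "beta_cdf 1 (real m) \<tau> = 1 - (1 - \<tau>) ^ m"
      using beta_cdf_eq_binomial_tail[of 1 m \<tau>] binomial_tail_from_1[OF m_pos, of \<tau>] m_pos \<tau>
      by (simp add: max_def min_def)
    then show ?thesis using x_eq_q_1 \<tau> by simp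
  qed
  also have "((1 - \<tau>) ^ m * ((x - beta_cdf 1 (real m) \<tau>) / (1 - beta_cdf 1 (real m) \<tau>))) * of_bool (q 1 > \<tau>)
        + binomial_tail m 1 \<tau> - (\<Sum>i = 1..m. real (m choose i) * (g i * (1 - \<tau>) ^ (m - i)))
      = ((1 - \<tau>) ^ m * ((x - beta_cdf 1 (real m) \<tau>) / (1 - beta_cdf 1 (real m) \<tau>))) * of_bool (q 1 > \<tau>)
        + (\<Sum>i = 1..m. real (m choose i) * \<tau> ^ i * (1 - \<tau>) ^ (m - i)
          * (1 - fact i / \<tau> ^ i * (Q_tilde q m \<tau> i - Q_bar q m i) * of_bool (q i \<le> \<tau>)))"
    unfolding binomial_tail_def add_diff_eq[symmetric] sum_subtractf[symmetric]
    using \<tau>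
    by (intro arg_cong2[where f = "(+)"] refl sum.cong)
       (auto simp: Q_tilde_minus_Q_bar g_def field_simps)
  finally show ?thesis unfolding c_def .
qed

end

theorem theorem1:
  fixes M :: "'a measure" and m :: nat and P :: "nat \<Rightarrow> 'a \<Rightarrow> real"
    and x :: real and q :: "nat \<Rightarrow> real"
  assumes "prob_space M"
    and "m \<ge> 1"
    and "prob_space.indep_vars M (\<lambda>_. borel) P {1..m}"
    and "\<And>i. i \<in> {1..m} \<Longrightarrow> distr M borel (P i) = uniform_measure lborel {0..1}"
    and "0 < x" and "x < 1"
    and "\<And>i. i \<in> {1..m} \<Longrightarrow> beta_cdf (real i) (real (m + 1 - i)) (q i) = x"
  shows "(\<forall>c \<in> {1..m}.
            gamma_inf M m P (\<lambda>_. c) x =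
              q c ^ m + (\<Sum>i = 1..m - 1. fact m / fact (m - i) * Q_bar q c i * (1 - q c ^ (m - i))))
       \<and> (\<forall>\<tau>. 0 < \<tau> \<longrightarrow> \<tau> < 1 \<longrightarrow>
            gamma_inf M m P (\<lambda>\<omega>. random_cutoff m \<tau> (\<lambda>i. P i \<omega>)) x =
              (1 - \<tau>) ^ m * ((x - beta_cdf 1 (real m) \<tau>) / (1 - beta_cdf 1 (real m) \<tau>))
                * of_bool (q 1 > \<tau>)
              + (\<Sum>i = 1..m. real (m choose i) * \<tau> ^ i * (1 - \<tau>) ^ (m - i)
                  * (1 - fact i / \<tau> ^ i * (Q_tilde q m \<tau> i - Q_bar q m i) * of_bool (q i \<le> \<tau>))))"
proof -
  interpret prob_space M by fact
  interpret order_stat_quantiles M P m x q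
    by unfold_locales (use assms in auto)
  show ?thesis using gamma_inf_fixed gamma_inf_random by blast
qed

end
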